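(* Consider the $N$-player difference game with inequality constraints NZDG described in the context, under the standing assumptions listed there. Suppose the players' cost functions satisfy, for all $i,j\in\mathcal N$ (identically in all arguments), $$\frac{\partial^2 g_k^i}{\partial (u_k^j)^\prime\,\partial u_k^i}=\left(\frac{\partial^2 g_k^j}{\partial (u_k^i)^\prime\,\partial u_k^j}\right)^\prime,\quad k\in\mathcal K\setminus\{K\},$$ $$\frac{\partial g_k^i}{\partial x_k}=\frac{\partial g_k^j}{\partial x_k},\quad k\in\mathcal K,$$ $$\frac{\partial^2 g_k^i}{\partial (v_k^j)^\prime\,\partial v_k^i}=\left(\frac{\partial^2 g_k^j}{\partial (v_k^i)^\prime\,\partial v_k^j}\right)^\prime,\quad k\in\mathcal K.$$ Then NZDG is an open-loop potential difference game (OLPDG). Moreover, define $\Omega_k=X_k\times\prod_{i\in\mathcal N}U_k^i\times\prod_{i\in\mathcal N}V_k^i$ for $k\in\mathcal K\setminus\{K\}$, $\Omega_K=X_K\times\prod_{i\in\mathcal N}V_K^i$, and the vector fields $$F_k(x_k,\mathbf u_k,\mathbf v_k)=\begin{bmatrix}\left(\frac{\partial g_k^1}{\partial x_k}\right)^\prime&\left(\frac{\partial g_k^1}{\partial u_k^1}\right)^\prime&\cdots&\left(\frac{\partial g_k^N}{\partial u_k^N}\right)^\prime&\left(\frac{\partial g_k^1}{\partial v_k^1}\right)^\prime&\cdots&\left(\frac{\partial g_k^N}{\partial v_k^N}\right)^\prime\end{bmatrix}^\prime,\quad k\in\mathcal K\setminus\{K\},$$ $$F_K(x_K,\mathbf v_K)=\begin{bmatrix}\left(\frac{\partial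 g_K^1}{\partial x_K}\right)^\prime&\left(\frac{\partial g_K^1}{\partial v_K^1}\right)^\prime&\cdots&\left(\frac{\partial g_K^N}{\partial v_K^N}\right)^\prime\end{bmatrix}^\prime.$$ Then the instantaneous and terminal potential functions are given by $$P_k(x_k,\mathbf u_k,\mathbf v_k)=c_k+\int_0^1F_k(\alpha_k(z))\cdot\frac{\partial\alpha_k(z)}{\partial z}\,dz,\quad k\in\mathcal K\setminus\{K\},$$ $$P_K(x_K,\mathbf v_K)=c_K+\int_0^1F_K(\alpha_K(z))\cdot\frac{\partial\alpha_K(z)}{\partial z}\,dz,$$ where $\cdot$ is the dot product, $\alpha_k:[0,1]\to\mathcal C_k$ ($k\in\mathcal K$) is a bijective parametrization of a piecewise smooth curve $\mathcal C_k\subset\Omega_k$ with $\alpha_k(0)=(x_{0k},\mathbf u_{0k},\mathbf v_{0k})$ a fixed point of $\Omega_k$ and $\alpha_k(1)=(x_k,\mathbf u_k,\mathbf v_k)$ for $k\in\mathcal K\setminus\{K\}$, $\alpha_K(0)=(x_{0K},\mathbf v_{0K})$ a fixed point of $\Omega_K$ and $\alpha_K(1)=(x_K,\mathbf v_K)$, and $\{c_k,\ k\in\mathcal K\}$ are constants.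
   Context: Players $\mathcal N=\{1,\dots,N\}$, time periods $\mathcal K=\{0,1,\dots,K\}$. At time $k$ player $i$ chooses $u_k^i\in U_k^i\subset\mathbb R^{m_i}$ (for $k\in\mathcal K\setminus\{K\}$) and $v_k^i\in V_k^i\subset\mathbb R^{s_i}$ (for $k\in\mathcal K$). Put $m=\sum_i m_i$, $s=\sum_i s_i$, $\mathbf u_k=(u_k^1,\dots,u_k^N)\in\mathbb R^m$, $\mathbf v_k=(v_k^1,\dots,v_k^N)\in\mathbb R^s$. The state $x_k\in X_k\subset\mathbb R^n$ ($X_k$ the set of admissible states at time $k$) evolves by $$x_{k+1}=f_k(x_k,\mathbf u_k),\quad k\in\mathcal K\setminus\{K\},\quad x_0\text{ given},$$ and the players face the coupled constraints $h_k(x_k,\mathbf v_k)\ge 0$, $\mathbf v_k\ge 0$, $k\in\mathcal K$ (componentwise, $h_k$ vector valued). A strategy of player $i$ is a pair of time sequences (open-loop) $\tilde u^i=\{u_k^i\}_{k\in\mathcal K\setminus\{K\}}$, $\tilde v^i=\{v_k^i\}_{k\in\mathcal K}$; $-i$ denotes the players other than $i$, $\tilde{\mathbf u}=(\tilde u^i,\tilde u^{-i})$, $\tilde{\mathbf v}=(\tilde v^i,\tilde v^{-i})$. A pair $(\tilde{\mathbf u},\tilde{\mathbf v})$ is admissible if the actions lie in the action sets and the constraints hold along the state trajectory generated by $\tilde{\mathbf u}$. NZDG: player $i$ minimizes over $(\tilde u^i,\tilde v^i)$ the cost $J^i(x_0,\tilde{\mathbf u},\tilde{\mathbf v})=g_K^i(x_K,\mathbf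 v_K)+\sum_{k=0}^{K-1}g_k^i(x_k,\mathbf u_k,\mathbf v_k)$ subject to the dynamics and constraints. An admissible profile $(\tilde{\mathbf u}^*,\tilde{\mathbf v}^* )$ is an open-loop Nash equilibrium if for every $i$, $(\tilde u^{i*},\tilde v^{i*})$ minimizes $J^i(x_0,(\tilde u^i,\tilde u^{-i*}),(\tilde v^i,\tilde v^{-i*}))$ over all $(\tilde u^i,\tilde v^i)$ such that $((\tilde u^i,\tilde u^{-i*}),(\tilde v^i,\tilde v^{-i*}))$ is admissible. OCP (for given cost functions $P_k$): minimize over admissible $(\tilde{\mathbf u},\tilde{\mathbf v})$ (same dynamics and constraints) $J(x_0,\tilde{\mathbf u},\tilde{\mathbf v})=P_K(x_K,\mathbf v_K)+\sum_{k=0}^{K-1}P_k(x_k,\mathbf u_k,\mathbf v_k)$. NZDG is an open-loop potential difference game (OLPDG) if there exist (twice continuously differentiable) cost functions $\{P_k,\ k\in\mathcal K\}$ such that the optimal solution of OCP is an open-loop Nash equilibrium of NZDG; such $P_k$ are called potential (cost) functions. Derivative convention: $\partial g/\partial y$ is the column gradient, and $\partial^2 g/\partial (y)^\prime\partial w$ is the matrix whose rows are indexed by the components of $w$ and whose columns by those of $y$. $^\prime$ denotes transpose. Standing assumptions. The sets $U_k^i$ are such that the sets of state vectors $X_k$, $k\in\mathcal K$, are convex, and the feasible action sets $V_k^i(x_k,v_k^{-i})=\{v_k^i\in\mathbb R^{s_i}: h_k(x_k,\mathbf v_k)\ge 0,\ \mathbf v_k\ge 0\}$, $x_k\in X_k$,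 are non-empty, convex and bounded for all $k\in\mathcal K$, $i\in\mathcal N$. The costs are separable: $g_k^i(x_k,\mathbf u_k,\mathbf v_k)=gu_k^i(x_k,\mathbf u_k)+gv_k^i(x_k,\mathbf v_k)$ for $k\in\mathcal K\setminus\{K\}$. The functions $f_k,h_k,g_k^i$ are twice continuously differentiable in their arguments (on the whole Euclidean spaces). *)

theory Defs
  imports "HOL-Analysis.Analysis"
begin

definition C2 :: "('a::euclidean_space \<Rightarrow> 'b::real_normed_vector) \<Rightarrow> bool" where
  "C2 \<phi> \<longleftrightarrow> (\<exists>(\<phi>' :: 'a \<Rightarrow> 'a \<Rightarrow>\<^sub>L 'b) (\<phi>'' :: 'a \<Rightarrow> 'a \<Rightarrow>\<^sub>L ('a \<Rightarrow>\<^sub>L 'b)).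
     (\<forall>z. (\<phi> has_derivative blinfun_apply (\<phi>' z)) (at z)) \<and>
     (\<forall>z. (\<phi>' has_derivative blinfun_apply (\<phi>'' z)) (at z)) \<and>
     continuous_on UNIV \<phi>'')"

definition grad :: "('a::real_inner \<Rightarrow> real) \<Rightarrow> 'a \<Rightarrow> 'a" where
  "grad \<phi> z = (THE D. GDERIV \<phi> z :> D)"

text \<open>
  Players are numbered 1, ..., N and may have action spaces of different dimensions. The joint
  action of all players is a vector \<open>y\<close> with coordinates in a finite type \<open>'m\<close>, and an ownership
  map \<open>own :: 'm \<Rightarrow> nat\<close> tells which player controls which coordinate. The action space of
  player \<open>i\<close> (a Euclidean space of dimension \<open>card {a. own a = i}\<close>) is identified with the
  coordinate subspace \<open>block own i\<close> of the joint space, and the component \<open>y^i\<close> of \<open>y\<close> with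
  \<open>component own i y\<close>. The vector \<open>replace own i w y\<close> is \<open>(w^i, y^{-i})\<close>; it only
  depends on the coordinates of \<open>w\<close> owned by \<open>i\<close> and those of \<open>y\<close> not owned by \<open>i\<close>.
\<close>

definition block :: "('m::finite \<Rightarrow> nat) \<Rightarrow> nat \<Rightarrow> (real^'m) set" where
  "block own i = {w. \<forall>a. own a \<noteq> i \<longrightarrow> w $ a = 0}"

definition component :: "('m::finite \<Rightarrow> nat) \<Rightarrow> nat \<Rightarrow> real^'m \<Rightarrow> real^'m" where
  "component own i y = (\<chi> a. if own a = i then y $ a else 0)"

definition replace :: "('m::finite \<Rightarrow> nat) \<Rightarrow> nat \<Rightarrow> real^'m \<Rightarrow> real^'m \<Rightarrow> real^'m" where
  "replace own i w y = (\<chi> a. if own a = i then w $ a else y $ a)"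

text \<open>
  \<open>pgrad own i \<phi> y\<close> is the partial gradient of \<open>\<phi>\<close> with respect to \<open>y^i\<close>, an element of
  \<open>block own i\<close>. \<open>mixed own j i \<phi> y\<close> is the matrix of second derivatives
  of \<open>\<phi>\<close> with respect to \<open>(y^j)'\<close> and \<open>y^i\<close>: rows belong to the coordinates of \<open>y^i\<close>, columns to
  those of \<open>y^j\<close>, and all entries outside this block are zero.
\<close>

definition pgrad :: "('m::finite \<Rightarrow> nat) \<Rightarrow> nat \<Rightarrow> (real^'m \<Rightarrow> real) \<Rightarrow> real^'m \<Rightarrow> real^'m" where
  "pgrad own i \<phi> y = grad (\<lambda>w. \<phi> (replace own i w y)) y"

definition mixed ::
  "('m::finite \<Rightarrow> nat) \<Rightarrow> nat \<Rightarrow> nat \<Rightarrow> (real^'m \<Rightarrow> real) \<Rightarrow> real^'m \<Rightarrow> real^'m^'m" where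
  "mixed own j i \<phi> y = jacobian (\<lambda>w. pgrad own i \<phi> (replace own j w y)) (at y)"

text \<open>
  Costs and constraints take tuples \<open>(x, u, v)\<close> resp. \<open>(x, v)\<close>. Player indices come before time
  indices in the cost functions; the terminal cost has its own field because its type differs.
\<close>

record ('n::finite, 'm::finite, 's::finite, 'q::finite) nzdg =
  nplayers :: nat
  horizon :: nat
  uown :: "'m \<Rightarrow> nat"
  vown :: "'s \<Rightarrow> nat"
  init :: "real^'n"
  states :: "nat \<Rightarrow> (real^'n) set"
  uactions :: "nat \<Rightarrow> nat \<Rightarrow> (real^'m) set"  \<comment> \<open>time, player\<close>
  vactions :: "nat \<Rightarrow> nat \<Rightarrow> (real^'s) set"  \<comment> \<open>time, player\<close>
  dyn :: "nat \<Rightarrow> (real^'n) \<times> (real^'m) \<Rightarrow> real^'n"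
  constr :: "nat \<Rightarrow> (real^'n) \<times> (real^'s) \<Rightarrow> real^'q"
  cost :: "nat \<Rightarrow> nat \<Rightarrow> (real^'n) \<times> (real^'m) \<times> (real^'s) \<Rightarrow> real"  \<comment> \<open>player, time\<close>
  tcost :: "nat \<Rightarrow> (real^'n) \<times> (real^'s) \<Rightarrow> real"  \<comment> \<open>player\<close>

definition players :: "('n::finite, 'm::finite, 's::finite, 'q::finite) nzdg \<Rightarrow> nat set" where
  "players G = {1..nplayers G}"

definition game_data :: "('n::finite, 'm::finite, 's::finite, 'q::finite) nzdg \<Rightarrow> bool" where
  "game_data G \<longleftrightarrow>
     range (uown G) \<subseteq> players G \<and> range (vown G) \<subseteq> players G \<and>
     init G \<in> states G 0 \<and>
     (\<forall>k<horizon G. \<forall>i\<in>players G. uactions G k i \<subseteq> block (uown G) i) \<and>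
     (\<forall>k\<le>horizon G. \<forall>i\<in>players G. vactions G k i \<subseteq> block (vown G) i)"

definition uprofiles ::
  "('n::finite, 'm::finite, 's::finite, 'q::finite) nzdg \<Rightarrow> nat \<Rightarrow> (real^'m) set" where
  "uprofiles G k = {u. \<forall>i\<in>players G. component (uown G) i u \<in> uactions G k i}"

definition vprofiles ::
  "('n::finite, 'm::finite, 's::finite, 'q::finite) nzdg \<Rightarrow> nat \<Rightarrow> (real^'s) set" where
  "vprofiles G k = {v. \<forall>i\<in>players G. component (vown G) i v \<in> vactions G k i}"

primrec trajectory ::
  "('n::finite, 'm::finite, 's::finite, 'q::finite) nzdg \<Rightarrow> (nat \<Rightarrow> real^'m) \<Rightarrow> nat \<Rightarrow> real^'n" where
  "trajectory G u 0 = init G"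
| "trajectory G u (Suc k) = dyn G k (trajectory G u k, u k)"

text \<open>
  A profile of open-loop strategies is a pair of sequences of joint actions; only the values
  \<open>u k\<close> for \<open>k < K\<close> and \<open>v k\<close> for \<open>k \<le> K\<close> matter. The order on vectors is componentwise.
\<close>

definition admissible ::
  "('n::finite, 'm::finite, 's::finite, 'q::finite) nzdg \<Rightarrow>
    (nat \<Rightarrow> real^'m) \<Rightarrow> (nat \<Rightarrow> real^'s) \<Rightarrow> bool" where
  "admissible G u v \<longleftrightarrow>
     (\<forall>k<horizon G. u k \<in> uprofiles G k) \<and>
     (\<forall>k\<le>horizon G. v k \<in> vprofiles G k \<and> trajectory G u k \<in> states G k \<and>
        0 \<le> constr G k (trajectory G u k, v k) \<and> 0 \<le> v k)"

definition total_cost ::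
  "('n::finite, 'm::finite, 's::finite, 'q::finite) nzdg \<Rightarrow>
    (nat \<Rightarrow> (real^'n) \<times> (real^'m) \<times> (real^'s) \<Rightarrow> real) \<Rightarrow> ((real^'n) \<times> (real^'s) \<Rightarrow> real) \<Rightarrow>
    (nat \<Rightarrow> real^'m) \<Rightarrow> (nat \<Rightarrow> real^'s) \<Rightarrow> real" where
  "total_cost G p pT u v =
     pT (trajectory G u (horizon G), v (horizon G)) +
     (\<Sum>k<horizon G. p k (trajectory G u k, u k, v k))"

definition open_loop_nash ::
  "('n::finite, 'm::finite, 's::finite, 'q::finite) nzdg \<Rightarrow>
    (nat \<Rightarrow> real^'m) \<Rightarrow> (nat \<Rightarrow> real^'s) \<Rightarrow> bool" where
  "open_loop_nash G us vs \<longleftrightarrow> admissible G us vs \<and>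
     (\<forall>i\<in>players G. \<forall>ui vi.
        let u = (\<lambda>k. replace (uown G) i (ui k) (us k));
            v = (\<lambda>k. replace (vown G) i (vi k) (vs k))
        in admissible G u v \<longrightarrow>
           total_cost G (cost G i) (tcost G i) us vs \<le> total_cost G (cost G i) (tcost G i) u v)"

definition ocp_optimal ::
  "('n::finite, 'm::finite, 's::finite, 'q::finite) nzdg \<Rightarrow>
    (nat \<Rightarrow> (real^'n) \<times> (real^'m) \<times> (real^'s) \<Rightarrow> real) \<Rightarrow> ((real^'n) \<times> (real^'s) \<Rightarrow> real) \<Rightarrow>
    (nat \<Rightarrow> real^'m) \<Rightarrow> (nat \<Rightarrow> real^'s) \<Rightarrow> bool" where
  "ocp_optimal G P PT us vs \<longleftrightarrow> admissible G us vs \<and>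
     (\<forall>u v. admissible G u v \<longrightarrow> total_cost G P PT us vs \<le> total_cost G P PT u v)"

definition potential_costs ::
  "('n::finite, 'm::finite, 's::finite, 'q::finite) nzdg \<Rightarrow>
    (nat \<Rightarrow> (real^'n) \<times> (real^'m) \<times> (real^'s) \<Rightarrow> real) \<Rightarrow> ((real^'n) \<times> (real^'s) \<Rightarrow> real) \<Rightarrow> bool" where
  "potential_costs G P PT \<longleftrightarrow>
     (\<forall>k<horizon G. C2 (P k)) \<and> C2 PT \<and>
     (\<forall>us vs. ocp_optimal G P PT us vs \<longrightarrow> open_loop_nash G us vs)"

definition OLPDG :: "('n::finite, 'm::finite, 's::finite, 'q::finite) nzdg \<Rightarrow> bool" where
  "OLPDG G \<longleftrightarrow> (\<exists>P PT. potential_costs G P PT)"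

text \<open>The feasible actions of player \<open>i\<close> against \<open>v^{-i}\<close>; the coordinates of \<open>v\<close> owned by
  \<open>i\<close> are ignored.\<close>

definition feasible ::
  "('n::finite, 'm::finite, 's::finite, 'q::finite) nzdg \<Rightarrow>
    nat \<Rightarrow> nat \<Rightarrow> real^'n \<Rightarrow> real^'s \<Rightarrow> (real^'s) set" where
  "feasible G k i x v =
     {w \<in> block (vown G) i.
        0 \<le> constr G k (x, replace (vown G) i w v) \<and> 0 \<le> replace (vown G) i w v}"

text \<open>
  Non-emptiness of the feasible set is only meaningful for opponents' actions that are
  nonnegative themselves, since otherwise the set is empty by definition.
\<close>

definition standing_assumptions ::
  "('n::finite, 'm::finite, 's::finite, 'q::finite) nzdg \<Rightarrow> bool" where
  "standing_assumptions G \<longleftrightarrow>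
     (\<forall>k\<le>horizon G. convex (states G k)) \<and>
     (\<forall>k\<le>horizon G. \<forall>i\<in>players G. \<forall>x\<in>states G k. \<forall>v.
        (\<forall>j\<in>players G - {i}. component (vown G) j v \<in> vactions G k j \<and> 0 \<le> component (vown G) j v) \<longrightarrow>
        feasible G k i x v \<noteq> {} \<and> convex (feasible G k i x v) \<and> bounded (feasible G k i x v)) \<and>
     (\<exists>gu gv. \<forall>i\<in>players G. \<forall>k<horizon G. \<forall>x u v.
        cost G i k (x, u, v) = gu i k (x, u) + gv i k (x, v)) \<and>
     (\<forall>k<horizon G. C2 (dyn G k)) \<and>
     (\<forall>k\<le>horizon G. C2 (constr G k)) \<and>
     (\<forall>i\<in>players G. (\<forall>k<horizon G. C2 (cost G i k)) \<and> C2 (tcost G i))"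

definition Omega ::
  "('n::finite, 'm::finite, 's::finite, 'q::finite) nzdg \<Rightarrow>
    nat \<Rightarrow> ((real^'n) \<times> (real^'m) \<times> (real^'s)) set" where
  "Omega G k = states G k \<times> uprofiles G k \<times> vprofiles G k"

definition OmegaT ::
  "('n::finite, 'm::finite, 's::finite, 'q::finite) nzdg \<Rightarrow> ((real^'n) \<times> (real^'s)) set" where
  "OmegaT G = states G (horizon G) \<times> vprofiles G (horizon G)"

text \<open>The partial gradients of different players live in complementary coordinate subspaces, so
  stacking them is the same as adding them.\<close>

definition grad_field ::
  "('n::finite, 'm::finite, 's::finite, 'q::finite) nzdg \<Rightarrow>
    nat \<Rightarrow> (real^'n) \<times> (real^'m) \<times> (real^'s) \<Rightarrow> (real^'n) \<times> (real^'m) \<times> (real^'s)" where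
  "grad_field G k = (\<lambda>(x, u, v).
     (grad (\<lambda>y. cost G 1 k (y, u, v)) x,
      \<Sum>i\<in>players G. pgrad (uown G) i (\<lambda>w. cost G i k (x, w, v)) u,
      \<Sum>i\<in>players G. pgrad (vown G) i (\<lambda>w. cost G i k (x, u, w)) v))"

definition grad_fieldT ::
  "('n::finite, 'm::finite, 's::finite, 'q::finite) nzdg \<Rightarrow>
    (real^'n) \<times> (real^'s) \<Rightarrow> (real^'n) \<times> (real^'s)" where
  "grad_fieldT G = (\<lambda>(x, v).
     (grad (\<lambda>y. tcost G 1 (y, v)) x,
      \<Sum>i\<in>players G. pgrad (vown G) i (\<lambda>w. tcost G i (x, w)) v))"

text \<open>\<open>valid_path\<close> is the library notion of a piecewise smooth parametrisation (continuous, and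
  continuously differentiable off a finite set), \<open>arc\<close> adds bijectivity onto the image.\<close>

definition curve_in :: "'a::euclidean_space set \<Rightarrow> 'a \<Rightarrow> 'a \<Rightarrow> (real \<Rightarrow> 'a) \<Rightarrow> bool" where
  "curve_in S a b \<alpha> \<longleftrightarrow>
     arc \<alpha> \<and> valid_path \<alpha> \<and> path_image \<alpha> \<subseteq> S \<and> pathstart \<alpha> = a \<and> pathfinish \<alpha> = b"

text \<open>
  \<open>p\<close> is given on \<open>S\<close> by \<open>p z = c + \<integral> F \<cdot> d\<alpha>\<close>, for every choice of the curve \<open>\<alpha>\<close> from \<open>a\<close> to \<open>z\<close>.
  For \<open>z = a\<close> there is no injective parametrisation, and the integral is read as 0.
\<close>

definition line_integral_formula ::
  "'a::euclidean_space set \<Rightarrow> 'a \<Rightarrow> real \<Rightarrow> ('a \<Rightarrow> 'a) \<Rightarrow> ('a \<Rightarrow> real) \<Rightarrow> bool" where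
  "line_integral_formula S a c F p \<longleftrightarrow>
     p a = c \<and>
     (\<forall>z\<in>S. \<forall>\<alpha>. curve_in S a z \<alpha> \<longrightarrow>
        (\<lambda>t. F (\<alpha> t) \<bullet> vector_derivative \<alpha> (at t within {0..1})) integrable_on {0..1} \<and>
        p z = c + integral {0..1} (\<lambda>t. F (\<alpha> t) \<bullet> vector_derivative \<alpha> (at t within {0..1})))"

end

(* The condition on the mixed second derivatives, the common state gradient, separability and
   Schwarz' theorem say that the field F_k has a symmetric Jacobian, so by the Poincare lemma it
   is the gradient of some P_k, which is C^2 because F_k is C^1; the line integral formula is then
   the fundamental theorem of calculus. The difference g_k^i - P_k has zero gradient with respect
   to x, u^i and v^i, hence it depends on u^{-i}, v^{-i} only. A unilateral deviation of player i
   therefore changes J^i and J by the same amount, whatever it does to the state trajectory, so a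
   minimizer of J is a Nash equilibrium. *)

theory Submission
  imports Defs
begin

section \<open>Calculus: Poincare lemma and symmetry of second derivatives\<close>

lemma has_derivative_apply_blinfun:
  assumes "(f has_derivative blinfun_apply D) (at z)"
  shows "((\<lambda>z. blinfun_apply (f z) k) has_derivative (\<lambda>h. blinfun_apply (D h) k)) (at z)"
  by (rule bounded_linear.has_derivative[OF blinfun.bounded_linear_left assms])

text \<open>The whole space is star-shaped about the origin, so the potential can be taken as the
  integral of \<open>\<omega>\<close> along the segment from 0 to \<open>z\<close>. Differentiation
  under the integral sign and the symmetry \<open>sym\<close> turn the derivative of the integrand
  into the derivative of t \<open>\<omega>\<close>(tz) in t, which integrates to
  \<open>\<omega> z\<close>.\<close>

lemma poincare_covector_field:
  fixes \<omega> :: "'a::euclidean_space \<Rightarrow> 'a \<Rightarrow>\<^sub>L real" and \<omega>' :: "'a \<Rightarrow> 'a \<Rightarrow>\<^sub>L ('a \<Rightarrow>\<^sub>L real)"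
  assumes der: "\<And>z. (\<omega> has_derivative blinfun_apply (\<omega>' z)) (at z)"
    and cont: "continuous_on UNIV \<omega>'"
    and sym: "\<And>z h k. \<omega>' z h k = \<omega>' z k h"
  obtains P where "\<And>z. (P has_derivative blinfun_apply (\<omega> z)) (at z)"
proof -
  define fx where "fx = (\<lambda>z t. t *\<^sub>R (blinfun_apply (\<omega>' (t *\<^sub>R z)) z) + \<omega> (t *\<^sub>R z))"
  have cont\<omega>: "continuous_on UNIV \<omega>"
    using der by (auto simp: continuous_on_eq_continuous_at intro: has_derivative_continuous)
  \<comment> \<open>By symmetry, \<open>fx z t\<close> is the derivative both of \<open>z \<mapsto> \<omega>(tz) z\<close> and of \<open>t \<mapsto> t \<omega>(tz)\<close>.\<close>
  note [continuous_intros] = continuous_on_compose2[OF cont] continuous_on_compose2[OF cont\<omega>]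
  have integrand: "((\<lambda>z. \<omega> (t *\<^sub>R z) z) has_derivative blinfun_apply (fx z t)) (at z)" for z t
    by (rule derivative_eq_intros has_derivative_compose[OF _ der] refl)+
      (auto simp: fx_def blinfun.bilinear_simps fun_eq_iff sym)
  have "((\<lambda>z. integral (cbox 0 1) (\<lambda>t. \<omega> (t *\<^sub>R z) z)) has_derivative
      integral (cbox 0 1) (fx z)) (at z)" for z
  proof (rule leibniz_rule[where U = UNIV])
    show "(\<lambda>t. \<omega> (t *\<^sub>R x) x) integrable_on cbox 0 1" for x
      by (intro integrable_continuous continuous_intros) auto
    show "continuous_on (UNIV \<times> cbox 0 1) (\<lambda>(x, t). fx x t)"
      unfolding fx_def case_prod_beta by (intro continuous_intros) auto
  qed (use integrand in auto)
  moreover have "integral (cbox 0 1) (fx z) = \<omega> z" for z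
  proof -
    have "((\<lambda>t. t *\<^sub>R \<omega> (t *\<^sub>R z)) has_vector_derivative fx z t) (at t within {0..1})" for t
      unfolding has_vector_derivative_def
      by (rule derivative_eq_intros has_derivative_compose[OF _ der] refl)+
        (auto simp: fx_def blinfun.bilinear_simps fun_eq_iff algebra_simps)
    then have "(fx z has_integral (1 *\<^sub>R \<omega> (1 *\<^sub>R z) - 0 *\<^sub>R \<omega> (0 *\<^sub>R z))) {0..1}"
      by (intro fundamental_theorem_of_calculus) auto
    then show ?thesis by (simp add: integral_unique)
  qed
  ultimately show thesis by (intro that) simp
qed

text \<open>The left-hand side below is invariant under swapping \<open>h\<close> and \<open>k\<close>, which is what yields the
  symmetry of the second derivative.\<close>

lemma second_difference_mean_value:
  fixes \<phi> :: "'a::real_normed_vector \<Rightarrow> real"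
  assumes d1: "\<And>z. (\<phi> has_derivative blinfun_apply (\<phi>' z)) (at z)"
    and d2: "\<And>z. (\<phi>' has_derivative blinfun_apply (\<phi>'' z)) (at z)"
    and "t > 0"
  obtains c d where "0 < c" "c < t" "0 < d" "d < t"
    "\<phi> (z + t *\<^sub>R h + t *\<^sub>R k) - \<phi> (z + t *\<^sub>R h) - (\<phi> (z + t *\<^sub>R k) - \<phi> z)
      = t\<^sup>2 * \<phi>'' (z + c *\<^sub>R h + d *\<^sub>R k) k h"
proof -
  \<comment> \<open>The mean value theorem is applied twice: first along \<open>h\<close>, to the
    difference of \<open>\<phi>\<close> between the line shifted by \<open>t *\<^sub>R k\<close> and
    the unshifted line, then along \<open>k\<close>, to the derivative in direction
    \<open>h\<close>.\<close>
  have "((\<lambda>s. \<phi> (z + s *\<^sub>R h + t *\<^sub>R k) - \<phi> (z + s *\<^sub>R h)) has_field_derivative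
      (\<phi>' (z + s *\<^sub>R h + t *\<^sub>R k) h - \<phi>' (z + s *\<^sub>R h) h)) (at s)" for s
    unfolding has_field_derivative_def
    by (rule derivative_eq_intros has_derivative_compose[OF _ d1] refl)+
      (auto simp: blinfun.bilinear_simps fun_eq_iff algebra_simps)
  from MVT2[OF \<open>t > 0\<close> this] obtain c where c: "0 < c" "c < t"
    "\<phi> (z + t *\<^sub>R h + t *\<^sub>R k) - \<phi> (z + t *\<^sub>R h) - (\<phi> (z + t *\<^sub>R k) - \<phi> z)
      = t * (\<phi>' (z + c *\<^sub>R h + t *\<^sub>R k) h - \<phi>' (z + c *\<^sub>R h) h)"
    by auto
  have "((\<lambda>s. \<phi>' (z + c *\<^sub>R h + s *\<^sub>R k) h) has_field_derivative
      \<phi>'' (z + c *\<^sub>R h + s *\<^sub>R k) k h) (at s)" for s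
    unfolding has_field_derivative_def
    by (rule derivative_eq_intros has_derivative_compose[OF _ d2] refl)+
      (auto simp: blinfun.bilinear_simps fun_eq_iff algebra_simps)
  from MVT2[OF \<open>t > 0\<close> this] obtain d where "0 < d" "d < t"
    "\<phi>' (z + c *\<^sub>R h + t *\<^sub>R k) h - \<phi>' (z + c *\<^sub>R h) h = t * \<phi>'' (z + c *\<^sub>R h + d *\<^sub>R k) k h"
    by auto
  with c show thesis by (intro that[of c d]) (auto simp: power2_eq_square)
qed

text \<open>Schwarz' theorem: the second difference divided by the square of the step tends to the
  second derivative at \<open>z\<close>, by continuity of \<open>\<phi>''\<close>. Taking the two
  directions in either order gives two limits of the same sequence.\<close>

lemma symmetric_second_derivative:
  fixes \<phi> :: "'a::real_normed_vector \<Rightarrow> real"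
  assumes d1: "\<And>z. (\<phi> has_derivative blinfun_apply (\<phi>' z)) (at z)"
    and d2: "\<And>z. (\<phi>' has_derivative blinfun_apply (\<phi>'' z)) (at z)"
    and cont: "continuous_on UNIV \<phi>''"
  shows "\<phi>'' z h k = \<phi>'' z k h"
proof -
  define t where "t = (\<lambda>n. inverse (real (Suc n)))"
  define \<Delta> where "\<Delta> = (\<lambda>s. \<phi> (z + s *\<^sub>R h + s *\<^sub>R k) - \<phi> (z + s *\<^sub>R h) - (\<phi> (z + s *\<^sub>R k) - \<phi> z))"
  have t: "t n > 0" for n by (simp add: t_def)
  have t0: "t \<longlonglongrightarrow> 0" unfolding t_def by (rule LIMSEQ_inverse_real_of_nat)
  \<comment> \<open>Stated for arbitrary directions \<open>a\<close>, \<open>b\<close> whose second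
    difference is \<open>\<Delta>\<close>, so that it applies to the pair \<open>h\<close>,
    \<open>k\<close> in both orders.\<close>
  have lim: "(\<lambda>n. \<Delta> (t n) / (t n)\<^sup>2) \<longlonglongrightarrow> \<phi>'' z b a"
    if \<Delta>: "\<And>s. \<Delta> s = \<phi> (z + s *\<^sub>R a + s *\<^sub>R b) - \<phi> (z + s *\<^sub>R a) - (\<phi> (z + s *\<^sub>R b) - \<phi> z)" for a b
  proof -
    have "\<exists>c d. 0 < c \<and> c < t n \<and> 0 < d \<and> d < t n \<and>
        \<Delta> (t n) = (t n)\<^sup>2 * \<phi>'' (z + c *\<^sub>R a + d *\<^sub>R b) b a" for n
      unfolding \<Delta> using second_difference_mean_value[OF d1 d2 t] by metis
    then obtain c d where cd: "\<And>n. 0 < c n" "\<And>n. c n < t n" "\<And>n. 0 < d n" "\<And>n. d n < t n"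
      "\<And>n. \<Delta> (t n) = (t n)\<^sup>2 * \<phi>'' (z + c n *\<^sub>R a + d n *\<^sub>R b) b a"
      by metis
    have "c \<longlonglongrightarrow> 0" "d \<longlonglongrightarrow> 0"
      using cd by (auto intro!: tendsto_sandwich[OF _ _ tendsto_const t0] always_eventually less_imp_le)
    then have "(\<lambda>n. z + c n *\<^sub>R a + d n *\<^sub>R b) \<longlonglongrightarrow> z + 0 *\<^sub>R a + 0 *\<^sub>R b"
      by (intro tendsto_intros)
    then have "(\<lambda>n. \<phi>'' (z + c n *\<^sub>R a + d n *\<^sub>R b) b a) \<longlonglongrightarrow> \<phi>'' z b a"
      using cont by (intro tendsto_intros isCont_tendsto_compose[of z \<phi>''])
        (auto simp: continuous_on_eq_continuous_at)
    moreover have "\<Delta> (t n) / (t n)\<^sup>2 = \<phi>'' (z + c n *\<^sub>R a + d n *\<^sub>R b) b a" for n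
      using cd(5)[of n] t[of n] by simp
    ultimately show ?thesis by simp
  qed
  have "(\<lambda>n. \<Delta> (t n) / (t n)\<^sup>2) \<longlonglongrightarrow> \<phi>'' z k h" by (rule lim) (simp add: \<Delta>_def)
  moreover have "(\<lambda>n. \<Delta> (t n) / (t n)\<^sup>2) \<longlonglongrightarrow> \<phi>'' z h k"
    by (rule lim) (simp add: \<Delta>_def algebra_simps)
  ultimately show ?thesis by (rule LIMSEQ_unique[rotated])
qed

section \<open>Gradients and mixed derivatives on the players' coordinate blocks\<close>

text \<open>Resolves the definite description in \<open>grad\<close>: a linear functional on a
  Euclidean space is the inner product with exactly one vector, whose coordinates are its values on
  the basis.\<close>

lemma grad_inner:
  fixes \<phi> :: "'a::euclidean_space \<Rightarrow> real"
  assumes "(\<phi> has_derivative D) (at z)"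
  shows "grad \<phi> z \<bullet> h = D h"
proof -
  interpret D: bounded_linear D using assms by (rule has_derivative_bounded_linear)
  define d where "d = (\<Sum>b\<in>Basis. D b *\<^sub>R b)"
  have D: "D = (\<lambda>h. h \<bullet> d)"
  proof
    fix h
    have "D h = D (\<Sum>b\<in>Basis. (h \<bullet> b) *\<^sub>R b)" by (simp add: euclidean_representation)
    also have "\<dots> = h \<bullet> d" by (simp add: D.sum D.scaleR d_def inner_sum_right mult.commute)
    finally show "D h = h \<bullet> d" .
  qed
  have "grad \<phi> z = d"
    unfolding grad_def
  proof (rule the_equality)
    show "GDERIV \<phi> z :> d" using assms unfolding gderiv_def D .
    fix e assume "GDERIV \<phi> z :> e"
    then have "(\<lambda>h. h \<bullet> e) = D"
      using assms unfolding gderiv_def by (rule has_derivative_unique)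
    then have "\<forall>h. h \<bullet> e = h \<bullet> d" by (simp add: D fun_eq_iff)
    then show "e = d" by (rule vector_eq_ldot[THEN iffD1])
  qed
  then show ?thesis by (subst D) (simp add: inner_commute)
qed

lemma bounded_linear_component: "bounded_linear (component own i)"
  by (rule linear_conv_bounded_linear[THEN iffD1], rule linearI)
    (auto simp: component_def vec_eq_iff)

lemma replace_eq: "replace own i w y = component own i w + (y - component own i y)"
  by (auto simp: replace_def component_def vec_eq_iff)

lemma replace_has_derivative:
  "((\<lambda>w. replace own i w y) has_derivative component own i) (at w)"
  unfolding replace_eq
  by (rule derivative_eq_intros bounded_linear.has_derivative[OF bounded_linear_component] refl)+ simp

lemma replace_self [simp]: "replace own i y y = y"
  by (simp add: replace_eq)

lemma component_component [simp]:
  "component own i (component own j y) = (if i = j then component own i y else 0)"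
  by (auto simp: component_def vec_eq_iff)

text \<open>Every coordinate has exactly one owner, and that owner belongs to \<open>I\<close>, so
  the blocks decompose the space.\<close>

lemma sum_component:
  assumes "finite I" "range own \<subseteq> I"
  shows "(\<Sum>i\<in>I. component own i y) = y"
  unfolding vec_eq_iff
proof
  fix a
  have "own a \<in> I" using assms(2) by auto
  then show "(\<Sum>i\<in>I. component own i y) $ a = y $ a"
    using assms(1) by (simp add: component_def)
qed

text \<open>Chain rule through \<open>replace\<close>, whose derivative is the projection onto the
  block and which leaves the base point \<open>y\<close> fixed.\<close>

lemma pgrad_inner:
  assumes "(\<phi> has_derivative D) (at y)"
  shows "pgrad own i \<phi> y \<bullet> h = D (component own i h)"
  unfolding pgrad_def
  by (rule grad_inner, rule has_derivative_compose[OF replace_has_derivative]) (simp add: assms)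

text \<open>Replaces the matrix by the bilinear form of second derivatives: \<open>h\<close> is the
  column argument, projected to block \<open>j\<close>, and \<open>k\<close> the row argument,
  projected to block \<open>i\<close>. From here on no matrices have to be handled.\<close>

lemma mixed_inner:
  assumes d1: "\<And>y. (\<phi> has_derivative D y) (at y)"
    and d2: "\<And>k. ((\<lambda>y. D y k) has_derivative (\<lambda>h. D2 h k)) (at y)"
    and lin: "\<And>h. linear (D2 h)"
  shows "(mixed own j i \<phi> y *v h) \<bullet> k = D2 (component own j h) (component own i k)"
proof -
  define L where "L h = (\<Sum>b\<in>Basis. D2 (component own j h) (component own i b) *\<^sub>R b)" for h
  \<comment> \<open>Expanding the partial gradient in the basis reduces its derivative to scalar
    functions, for which \<open>d2\<close> is available.\<close>
  have pg: "pgrad own i \<phi> w = (\<Sum>b\<in>Basis. D w (component own i b) *\<^sub>R b)" for w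
    by (rule euclidean_eqI) (simp add: pgrad_inner[OF d1])
  have "((\<lambda>w. D (replace own j w y) q) has_derivative (\<lambda>h. D2 (component own j h) q)) (at y)" for q
    by (rule has_derivative_compose[OF replace_has_derivative, of "\<lambda>y. D y q" "\<lambda>h. D2 h q"]) (simp add: d2)
  then have "((\<lambda>w. pgrad own i \<phi> (replace own j w y)) has_derivative L) (at y)"
    unfolding pg L_def[abs_def] by (intro has_derivative_sum has_derivative_scaleR_left)
  moreover from this have "(\<lambda>w. pgrad own i \<phi> (replace own j w y)) differentiable (at y)"
    by (rule differentiableI)
  ultimately have mL: "mixed own j i \<phi> y *v h = L h"
    unfolding mixed_def using has_derivative_unique jacobian_works by metis
  have "linear (\<lambda>k. D2 (component own j h) (component own i k))"
    using linear_compose[OF bounded_linear.linear[OF bounded_linear_component] lin]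
    by (simp add: o_def)
  then interpret D2: linear "\<lambda>k. D2 (component own j h) (component own i k)" .
  have "D2 (component own j h) (component own i k)
      = D2 (component own j h) (component own i (\<Sum>b\<in>Basis. (k \<bullet> b) *\<^sub>R b))"
    by (simp add: euclidean_representation)
  also have "\<dots> = L h \<bullet> k"
    unfolding D2.sum by (simp add: D2.scaleR L_def inner_sum_left inner_commute[of k] mult.commute)
  finally show ?thesis by (simp add: mL)
qed

section \<open>Potentials of one-forms assembled from the players' derivatives\<close>

lemma C2_obtain_family:
  assumes "\<And>i. i \<in> I \<Longrightarrow> C2 (g i)"
  obtains g' g'' where
    "\<And>i z. i \<in> I \<Longrightarrow> (g i has_derivative blinfun_apply (g' i z)) (at z)"
    "\<And>i z. i \<in> I \<Longrightarrow> (g' i has_derivative blinfun_apply (g'' i z)) (at z)"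
    "\<And>i. i \<in> I \<Longrightarrow> continuous_on UNIV (g'' i)"
  using assms unfolding C2_def by metis

lemma C2_shift:
  assumes "C2 P"
  shows "C2 (\<lambda>z. P z + c)"
  using assms unfolding C2_def by (blast intro: has_derivative_add_const)

text \<open>The one-form takes its values on the block of \<open>i\<close> from the derivative of
  \<open>g i\<close>. Expanding both arguments of its derivative over the blocks, \<open>sym\<close>
  matches the entry for the blocks (i, j) with the one for (j, i), so the form is closed and has a
  potential; the potential is C^2 because the form is C^1.\<close>

lemma projected_potential:
  fixes g :: "'i \<Rightarrow> 'a::euclidean_space \<Rightarrow> real"
  assumes g': "\<And>i z. i \<in> I \<Longrightarrow> (g i has_derivative blinfun_apply (g' i z)) (at z)"
    and g'': "\<And>i z. i \<in> I \<Longrightarrow> (g' i has_derivative blinfun_apply (g'' i z)) (at z)"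
    and cont: "\<And>i. i \<in> I \<Longrightarrow> continuous_on UNIV (g'' i)"
    and \<pi>: "\<And>i. i \<in> I \<Longrightarrow> bounded_linear (\<pi> i)"
    and sum_\<pi>: "\<And>h. (\<Sum>i\<in>I. \<pi> i h) = h"
    and sym: "\<And>i j z h k. \<lbrakk>i \<in> I; j \<in> I\<rbrakk> \<Longrightarrow>
      g'' i z (\<pi> j h) (\<pi> i k) = g'' j z (\<pi> i k) (\<pi> j h)"
  obtains P where "C2 P" "\<And>z. (P has_derivative (\<lambda>h. \<Sum>i\<in>I. g' i z (\<pi> i h))) (at z)"
proof -
  \<comment> \<open>\<open>R i\<close> is precomposition with the projection \<open>\<pi> i\<close>,
    packaged as a bounded linear map so that \<open>\<omega>\<close> and its derivative are again
    operator valued. \<open>Q i\<close> equals \<open>\<pi> i\<close> only for \<open>i\<close> in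
    \<open>I\<close>, which suffices since all sums run over \<open>I\<close>.\<close>
  define Q where "Q = (\<lambda>i. Blinfun (\<pi> i))"
  have Q: "blinfun_apply (Q i) = \<pi> i" if "i \<in> I" for i
    unfolding Q_def using \<pi>[OF that] by (rule bounded_linear_Blinfun_apply)
  define R :: "'i \<Rightarrow> ('a \<Rightarrow>\<^sub>L real) \<Rightarrow>\<^sub>L ('a \<Rightarrow>\<^sub>L real)" where "R = (\<lambda>i. Blinfun (\<lambda>A. A o\<^sub>L Q i))"
  have R: "R i A = A o\<^sub>L Q i" for i A
    unfolding R_def
    by (simp add: bounded_linear_Blinfun_apply bounded_bilinear.bounded_linear_left
        bounded_bilinear_blinfun_compose)
  define \<omega> where "\<omega> = (\<lambda>z. \<Sum>i\<in>I. R i (g' i z))"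
  define \<omega>' where "\<omega>' = (\<lambda>z. \<Sum>i\<in>I. R i o\<^sub>L g'' i z)"
  have \<omega>: "\<omega> z h = (\<Sum>i\<in>I. g' i z (\<pi> i h))" for z h
    by (simp add: \<omega>_def blinfun.sum_left R Q)
  have \<omega>'_apply: "\<omega>' z h k = (\<Sum>i\<in>I. g'' i z h (\<pi> i k))" for z h k
    by (simp add: \<omega>'_def blinfun.sum_left R Q)
  have der: "(\<omega> has_derivative \<omega>' z) (at z)" for z
  proof -
    have "(\<omega> has_derivative (\<lambda>h. \<Sum>i\<in>I. R i (g'' i z h))) (at z)"
      unfolding \<omega>_def
      by (intro has_derivative_sum bounded_linear.has_derivative[OF blinfun.bounded_linear_right] g'')
    moreover have "(\<lambda>h. \<Sum>i\<in>I. R i (g'' i z h)) = \<omega>' z"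
      by (simp add: \<omega>'_def blinfun.sum_left fun_eq_iff)
    ultimately show ?thesis by simp
  qed
  have cont': "continuous_on UNIV \<omega>'"
    unfolding \<omega>'_def
    by (intro continuous_on_sum bounded_bilinear.continuous_on[OF bounded_bilinear_blinfun_compose]
        continuous_on_const cont)
  have "\<omega>' z h k = \<omega>' z k h" for z h k
  proof -
    have expand: "\<omega>' z a b = (\<Sum>i\<in>I. \<Sum>j\<in>I. g'' i z (\<pi> j a) (\<pi> i b))" for a b
    proof -
      have "g'' i z a = (\<Sum>j\<in>I. g'' i z (\<pi> j a))" for i
        using sum_\<pi>[of a] by (simp flip: blinfun.sum_right)
      then show ?thesis by (simp add: \<omega>'_apply blinfun.sum_left)
    qed
    \<comment> \<open>\<open>sym\<close> exchanges the arguments and at the same time passes from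
      \<open>i\<close> to \<open>j\<close>; after exchanging the summations this is the expansion
      with \<open>h\<close> and \<open>k\<close> swapped.\<close>
    have "\<omega>' z h k = (\<Sum>i\<in>I. \<Sum>j\<in>I. g'' j z (\<pi> i k) (\<pi> j h))"
      unfolding expand by (intro sum.cong refl sym)
    also have "\<dots> = \<omega>' z k h" unfolding expand by (rule sum.swap)
    finally show ?thesis .
  qed
  then obtain P where P: "\<And>z. (P has_derivative blinfun_apply (\<omega> z)) (at z)"
    using poincare_covector_field[OF der cont'] by blast
  moreover have "C2 P" unfolding C2_def using P der cont' by blast
  ultimately show thesis by (intro that) (simp_all flip: \<omega>)
qed

text \<open>Adds a block shared by all players, later the state. Entries involving this block are
  symmetric by \<open>common\<close> together with Schwarz' theorem, and \<open>sym\<close> covers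
  the rest. The last conclusion holds because \<open>g i\<close> and the potential have the same
  derivative in the shared block and in the block of \<open>i\<close>.\<close>

lemma block_potential:
  fixes g :: "'i \<Rightarrow> 'x::euclidean_space \<times> 'y::euclidean_space \<Rightarrow> real"
  assumes g': "\<And>i z. i \<in> I \<Longrightarrow> (g i has_derivative blinfun_apply (g' i z)) (at z)"
    and g'': "\<And>i z. i \<in> I \<Longrightarrow> (g' i has_derivative blinfun_apply (g'' i z)) (at z)"
    and cont: "\<And>i. i \<in> I \<Longrightarrow> continuous_on UNIV (g'' i)"
    and I: "finite I" "p \<in> I"
    and \<pi>: "\<And>i. i \<in> I \<Longrightarrow> bounded_linear (\<pi> i)"
    and sum_\<pi>: "\<And>h. (\<Sum>i\<in>I. \<pi> i h) = h"
    and \<pi>_\<pi>: "\<And>i j y. \<pi> i (\<pi> j y) = (if i = j then \<pi> i y else 0)"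
    and common: "\<And>i j z h. \<lbrakk>i \<in> I; j \<in> I\<rbrakk> \<Longrightarrow> g' i z (h, 0) = g' j z (h, 0)"
    and sym: "\<And>i j z h k. \<lbrakk>i \<in> I; j \<in> I\<rbrakk> \<Longrightarrow>
      g'' i z (0, \<pi> j h) (0, \<pi> i k) = g'' j z (0, \<pi> i k) (0, \<pi> j h)"
  obtains P where "C2 P"
    "\<And>z. (P has_derivative (\<lambda>(h, k). g' p z (h, 0) + (\<Sum>i\<in>I. g' i z (0, \<pi> i k)))) (at z)"
    "\<And>i x x' y k. i \<in> I \<Longrightarrow> g i (x', y + \<pi> i k) - P (x', y + \<pi> i k) = g i (x, y) - P (x, y)"
proof -
  \<comment> \<open>The state block is attributed to player \<open>p\<close>; by \<open>common\<close> the choice is immaterial.\<close>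
  define \<rho> where "\<rho> = (\<lambda>i (z :: 'x \<times> 'y). (if i = p then fst z else 0, \<pi> i (snd z)))"
  note schwarz = symmetric_second_derivative[OF g' g'' cont]
  \<comment> \<open>Differentiating the identity \<open>common\<close> once more; only the second
    argument is restricted to the shared block.\<close>
  have common'': "g'' i z h (a, 0) = g'' j z h (a, 0)" if "i \<in> I" "j \<in> I" for i j z h a
  proof -
    have "(\<lambda>z. g' i z (a, 0)) = (\<lambda>z. g' j z (a, 0))"
      using that by (intro ext common)
    then show ?thesis
      using has_derivative_apply_blinfun[OF g''[OF that(1)], of "(a, 0)" z]
        has_derivative_apply_blinfun[OF g''[OF that(2)], of "(a, 0)" z]
      by (metis has_derivative_unique)
  qed
  \<comment> \<open>Splitting both vectors into shared and own part gives four products. Where a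
    shared part occurs, \<open>common''\<close> changes the player while that part is in the second
    argument, and Schwarz' theorem exchanges the arguments; only the product of the own parts uses
    \<open>sym\<close>.\<close>
  have \<rho>_sym: "g'' i z (\<rho> j h) (\<rho> i k) = g'' j z (\<rho> i k) (\<rho> j h)" if "i \<in> I" "j \<in> I" for i j z h k
  proof -
    have split: "\<exists>a b. \<rho> l w = (a, 0) + (0, \<pi> l b)" for l w
      by (auto simp: \<rho>_def)
    obtain a b where ab: "\<rho> j h = (a, 0) + (0, \<pi> j b)" using split by blast
    obtain c d where cd: "\<rho> i k = (c, 0) + (0, \<pi> i d)" using split by blast
    note c = common''[OF that] and s = schwarz[OF that(1) that(1) that(1)] schwarz[OF that(2) that(2) that(2)]
    have "g'' i z (a, 0) (c, 0) = g'' j z (c, 0) (a, 0)"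
      using c[of z "(a, 0)" c] s(2)[of z "(a, 0)" "(c, 0)"] by simp
    moreover have "g'' i z (a, 0) (0, \<pi> i d) = g'' j z (0, \<pi> i d) (a, 0)"
      using c[of z "(0, \<pi> i d)" a] s(1)[of z "(a, 0)" "(0, \<pi> i d)"] by simp
    moreover have "g'' i z (0, \<pi> j b) (c, 0) = g'' j z (c, 0) (0, \<pi> j b)"
      using c[of z "(0, \<pi> j b)" c] s(2)[of z "(c, 0)" "(0, \<pi> j b)"] by simp
    ultimately show ?thesis
      unfolding ab cd blinfun.add_left blinfun.add_right using sym[OF that] by simp
  qed
  have \<rho>: "bounded_linear (\<rho> i)" if "i \<in> I" for i
    unfolding \<rho>_def using bounded_linear_compose[OF \<pi>[OF that] bounded_linear_snd]
    by (cases "i = p") (auto intro!: bounded_linear_Pair bounded_linear_fst bounded_linear_zero)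
  have "(\<Sum>i\<in>I. \<rho> i h) = h" for h
    using I by (simp add: \<rho>_def prod_eq_iff fst_sum snd_sum sum_\<pi>)
  from projected_potential[OF g' g'' cont \<rho> this \<rho>_sym] obtain P where
    P: "C2 P" "\<And>z. (P has_derivative (\<lambda>h. \<Sum>i\<in>I. g' i z (\<rho> i h))) (at z)" by blast
  have eq: "(\<Sum>i\<in>I. g' i z (\<rho> i (h, k))) = g' p z (h, 0) + (\<Sum>i\<in>I. g' i z (0, \<pi> i k))" for z h k
  proof -
    have "g' i z (\<rho> i (h, k)) = (if i = p then g' p z (h, 0) else 0) + g' i z (0, \<pi> i k)" for i
    proof -
      have "\<rho> i (h, k) = (if i = p then h else 0, 0) + (0, \<pi> i k)" by (simp add: \<rho>_def)
      then show ?thesis by (simp only: blinfun.add_right) (simp add: zero_prod_def[symmetric])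
    qed
    then show ?thesis using I by (simp add: sum.distrib)
  qed
  have dP: "(P has_derivative (\<lambda>(h, k). g' p z (h, 0) + (\<Sum>i\<in>I. g' i z (0, \<pi> i k)))) (at z)" for z
    by (rule has_derivative_eq_rhs[OF P(2)]) (auto simp: fun_eq_iff eq)
  have "g i (x', y + \<pi> i k) - P (x', y + \<pi> i k) = g i (x, y) - P (x, y)" if i: "i \<in> I" for i x x' y k
  proof -
    \<comment> \<open>Parametrises the points reached by moving the shared block freely and, from
      \<open>y\<close>, only the block of \<open>i\<close>. Along it the derivative of
      \<open>g i - P\<close> vanishes, since \<open>\<pi> j\<close> annihilates the block of
      \<open>i\<close> for all other \<open>j\<close>.\<close>
    let ?\<zeta> = "\<lambda>w. (fst w, y + \<pi> i (snd w))"
    have \<zeta>: "(?\<zeta> has_derivative (\<lambda>h. (fst h, \<pi> i (snd h)))) (at w)" for w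
      by (rule derivative_eq_intros bounded_linear.has_derivative[OF \<pi>[OF i]] refl)+ simp
    have "((\<lambda>w. g i (?\<zeta> w) - P (?\<zeta> w)) has_derivative (\<lambda>h. 0)) (at w)" for w
    proof (rule has_derivative_eq_rhs)
      let ?z = "?\<zeta> w"
      show "((\<lambda>w. g i (?\<zeta> w) - P (?\<zeta> w)) has_derivative (\<lambda>h. g' i ?z (fst h, \<pi> i (snd h)) -
          (g' p ?z (fst h, 0) + (\<Sum>j\<in>I. g' j ?z (0, \<pi> j (\<pi> i (snd h))))))) (at w)"
        using has_derivative_compose[OF \<zeta> g'[OF i]] has_derivative_compose[OF \<zeta> dP]
        by (intro has_derivative_diff) simp_all
      have "g' j ?z (0, \<pi> j (\<pi> i b)) = (if j = i then g' i ?z (0, \<pi> i b) else 0)" for j b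
        by (simp add: \<pi>_\<pi> zero_prod_def[symmetric])
      then have "(\<Sum>j\<in>I. g' j ?z (0, \<pi> j (\<pi> i b))) = g' i ?z (0, \<pi> i b)" for b
        using I i by simp
      moreover have "g' i ?z (fst h, \<pi> i (snd h)) = g' p ?z (fst h, 0) + g' i ?z (0, \<pi> i (snd h))" for h
        unfolding common[OF I(2) i] by (simp flip: blinfun.add_right)
      ultimately show "(\<lambda>h. g' i ?z (fst h, \<pi> i (snd h)) -
          (g' p ?z (fst h, 0) + (\<Sum>j\<in>I. g' j ?z (0, \<pi> j (\<pi> i (snd h)))))) = (\<lambda>h. 0)"
        by (simp only: diff_self)
    qed
    \<comment> \<open>The parameter \<open>(x, 0)\<close> stands for the point
      \<open>(x, y)\<close>, because \<open>\<pi> i\<close> maps 0 to 0.\<close>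
    from has_derivative_zero_unique[OF convex_UNIV this, of "(x', k)" "(x, 0)"]
    show ?thesis by (simp add: linear_0[OF bounded_linear.linear[OF \<pi>[OF i]]])
  qed
  with P(1) dP show thesis by (rule that)
qed

section \<open>Line integrals of gradient fields\<close>

text \<open>Fundamental theorem of calculus for \<open>P\<close> along the curve. The shift by
  \<open>c - P a\<close> gives the value \<open>c\<close> at the base point.\<close>

lemma line_integral_of_gradient:
  assumes P: "\<And>z. GDERIV P z :> F z"
  shows "line_integral_formula S a c F (\<lambda>z. P z + (c - P a))"
  unfolding line_integral_formula_def
proof (intro conjI ballI allI impI)
  fix z \<alpha>
  assume "curve_in S a z \<alpha>"
  then have "valid_path \<alpha>" and ends: "\<alpha> 0 = a" "\<alpha> 1 = z"
    by (auto simp: curve_in_def pathstart_def pathfinish_def)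
  then obtain T where T: "finite T" "\<alpha> C1_differentiable_on ({0..1} - T)" "continuous_on {0..1} \<alpha>"
    by (auto simp: valid_path_def piecewise_C1_differentiable_on_def)
  let ?f = "\<lambda>t. F (\<alpha> t) \<bullet> vector_derivative \<alpha> (at t within {0..1})"
  have "(?f has_integral (P (\<alpha> 1) - P (\<alpha> 0))) {0..1}"
  \<comment> \<open>This version needs the derivative only at interior points off the finite set
    \<open>T\<close> of break points, and continuity on the whole interval.\<close>
  proof (rule fundamental_theorem_of_calculus_interior_strong[OF T(1)])
    show "((\<lambda>t. P (\<alpha> t)) has_vector_derivative ?f t) (at t)" if t: "t \<in> {0<..<1} - T" for t
    proof -
      have "\<alpha> differentiable (at t)"
        using T(2) t by (auto simp: C1_differentiable_on_eq)
      then have \<alpha>: "(\<alpha> has_vector_derivative vector_derivative \<alpha> (at t)) (at t)"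
        by (simp add: vector_derivative_works)
      have "vector_derivative \<alpha> (at t within {0..1}) = vector_derivative \<alpha> (at t)"
        using t by (intro vector_derivative_at_within_ivl[OF \<alpha>]) auto
      moreover have "((\<lambda>t. P (\<alpha> t)) has_derivative
          (\<lambda>s. (s *\<^sub>R vector_derivative \<alpha> (at t)) \<bullet> F (\<alpha> t))) (at t)"
        using \<alpha> P[of "\<alpha> t"] unfolding has_vector_derivative_def gderiv_def
        by (rule has_derivative_compose)
      ultimately show ?thesis
        by (simp add: has_vector_derivative_def inner_commute)
    qed
    have "continuous_on UNIV P"
      using P has_derivative_continuous unfolding gderiv_def continuous_on_eq_continuous_at[OF open_UNIV]
      by blast
    then show "continuous_on {0..1} (\<lambda>t. P (\<alpha> t))"
      using T(3) continuous_on_compose2 by blast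
  qed simp
  then show "?f integrable_on {0..1}" "P z + (c - P a) = c + integral {0..1} ?f"
    by (auto simp: ends integral_unique has_integral_integrable)
qed simp

section \<open>From potentials to equilibria\<close>

text \<open>The states \<open>x\<close> and \<open>x'\<close> are independent because a deviation in
  \<open>u\<close> also moves the trajectory. The player's total cost and the potential then differ
  by the same amount before and after a deviation, so optimality carries over.\<close>

lemma potential_costs_if_deviation_invariant:
  assumes "\<And>k. k < horizon G \<Longrightarrow> C2 (P k)" and "C2 PT"
    and stage: "\<And>i k x x' u v w w'. \<lbrakk>i \<in> players G; k < horizon G\<rbrakk> \<Longrightarrow>
      cost G i k (x', replace (uown G) i w u, replace (vown G) i w' v)
        - P k (x', replace (uown G) i w u, replace (vown G) i w' v)
      = cost G i k (x, u, v) - P k (x, u, v)"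
    and terminal: "\<And>i x x' v w. i \<in> players G \<Longrightarrow>
      tcost G i (x', replace (vown G) i w v) - PT (x', replace (vown G) i w v)
      = tcost G i (x, v) - PT (x, v)"
  shows "potential_costs G P PT"
proof -
  have "open_loop_nash G us vs" if opt: "ocp_optimal G P PT us vs" for us vs
    unfolding open_loop_nash_def Let_def
  proof (intro conjI ballI allI impI)
    show "admissible G us vs" using opt by (simp add: ocp_optimal_def)
    fix i ui vi
    let ?u = "\<lambda>k. replace (uown G) i (ui k) (us k)" and ?v = "\<lambda>k. replace (vown G) i (vi k) (vs k)"
    assume i: "i \<in> players G" and adm: "admissible G ?u ?v"
    have split: "total_cost G (cost G i) (tcost G i) u v - total_cost G P PT u v =
        (tcost G i (trajectory G u (horizon G), v (horizon G)) - PT (trajectory G u (horizon G), v (horizon G)))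
        + (\<Sum>k<horizon G. cost G i k (trajectory G u k, u k, v k) - P k (trajectory G u k, u k, v k))" for u v
      by (simp add: total_cost_def sum_subtractf)
    have "total_cost G (cost G i) (tcost G i) ?u ?v - total_cost G P PT ?u ?v
        = total_cost G (cost G i) (tcost G i) us vs - total_cost G P PT us vs"
      unfolding split using i by (intro arg_cong2[of _ _ _ _ "(+)"] sum.cong terminal stage) auto
    moreover have "total_cost G P PT us vs \<le> total_cost G P PT ?u ?v"
      using opt adm by (simp add: ocp_optimal_def)
    ultimately show "total_cost G (cost G i) (tcost G i) us vs
        \<le> total_cost G (cost G i) (tcost G i) ?u ?v" by linarith
  qed
  then show ?thesis using assms(1,2) by (simp add: potential_costs_def)
qed

section \<open>The mixed derivative conditions as symmetry of second derivatives\<close>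

text \<open>\<open>\<iota>\<close> will insert one variable into the argument tuple, the others
  being frozen. Its derivative \<open>L\<close> is the same at every point, so the chain rule
  produces no second-order term from \<open>\<iota>\<close>.\<close>

lemma mixed_section_inner:
  assumes g': "\<And>z. (g has_derivative blinfun_apply (g' z)) (at z)"
    and g'': "\<And>z. (g' has_derivative blinfun_apply (g'' z)) (at z)"
    and \<iota>: "\<And>w. (\<iota> has_derivative L) (at w)"
  shows "(mixed own j i (\<lambda>w. g (\<iota> w)) y *v h) \<bullet> k =
    g'' (\<iota> y) (L (component own j h)) (L (component own i k))"
proof (rule mixed_inner[where D = "\<lambda>w h. g' (\<iota> w) (L h)" and ?D2.0 = "\<lambda>h k. g'' (\<iota> y) (L h) (L k)"])
  show "((\<lambda>w. g (\<iota> w)) has_derivative (\<lambda>h. g' (\<iota> w) (L h))) (at w)" for w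
    by (rule has_derivative_compose[OF \<iota> g'])
  show "((\<lambda>w. g' (\<iota> w) (L k)) has_derivative (\<lambda>h. g'' (\<iota> y) (L h) (L k))) (at y)" for k
    by (rule has_derivative_compose[OF \<iota> has_derivative_apply_blinfun[OF g'']])
  have "bounded_linear L" using \<iota> by (rule has_derivative_bounded_linear)
  then show "linear (\<lambda>k. g'' (\<iota> y) (L h) (L k))" for h
    by (intro bounded_linear.linear bounded_linear_compose[OF blinfun.bounded_linear_right])
qed

text \<open>Brings the transposition hypotheses of the game into the form demanded by
  \<open>block_potential\<close>: transposing the matrix exchanges the two arguments of its bilinear
  form.\<close>

lemma second_derivative_eq_if_mixed_transpose:
  assumes f: "\<And>z. (f has_derivative blinfun_apply (f' z)) (at z)"
      "\<And>z. (f' has_derivative blinfun_apply (f'' z)) (at z)"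
    and g: "\<And>z. (g has_derivative blinfun_apply (g' z)) (at z)"
      "\<And>z. (g' has_derivative blinfun_apply (g'' z)) (at z)"
    and \<iota>: "\<And>w. (\<iota> has_derivative L) (at w)"
    and eq: "mixed own j i (\<lambda>w. f (\<iota> w)) y = transpose (mixed own i j (\<lambda>w. g (\<iota> w)) y)"
  shows "f'' (\<iota> y) (L (component own j h)) (L (component own i k)) =
    g'' (\<iota> y) (L (component own i k)) (L (component own j h))"
proof -
  have "(mixed own j i (\<lambda>w. f (\<iota> w)) y *v h) \<bullet> k = (mixed own i j (\<lambda>w. g (\<iota> w)) y *v k) \<bullet> h"
    unfolding eq transpose_matrix_vector dot_lmul_matrix by (rule inner_commute)
  then show ?thesis
    by (simp only: mixed_section_inner[OF f \<iota>] mixed_section_inner[OF g \<iota>])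
qed

section \<open>Potentials for terminal and stage costs\<close>

text \<open>Instance of \<open>block_potential\<close> with the state as shared block and the
  coordinates of \<open>v\<close> divided by owner.\<close>

lemma terminal_potential:
  fixes g :: "nat \<Rightarrow> 'x::euclidean_space \<times> (real^'s::finite) \<Rightarrow> real"
  assumes I: "finite I" "p \<in> I" "range own \<subseteq> I"
    and C2: "\<And>i. i \<in> I \<Longrightarrow> C2 (g i)"
    and common: "\<And>i j x v. \<lbrakk>i \<in> I; j \<in> I\<rbrakk> \<Longrightarrow> grad (\<lambda>y. g i (y, v)) x = grad (\<lambda>y. g j (y, v)) x"
    and mixed: "\<And>i j x v. \<lbrakk>i \<in> I; j \<in> I\<rbrakk> \<Longrightarrow>
      mixed own j i (\<lambda>w. g i (x, w)) v = transpose (mixed own i j (\<lambda>w. g j (x, w)) v)"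
  obtains P where "C2 P"
    "\<And>x v. GDERIV P (x, v) :> (grad (\<lambda>y. g p (y, v)) x, \<Sum>i\<in>I. pgrad own i (\<lambda>w. g i (x, w)) v)"
    "\<And>i x x' v w. i \<in> I \<Longrightarrow>
      g i (x', replace own i w v) - P (x', replace own i w v) = g i (x, v) - P (x, v)"
proof -
  obtain g' g'' where g': "\<And>i z. i \<in> I \<Longrightarrow> (g i has_derivative blinfun_apply (g' i z)) (at z)"
    and g'': "\<And>i z. i \<in> I \<Longrightarrow> (g' i has_derivative blinfun_apply (g'' i z)) (at z)"
    and cont: "\<And>i. i \<in> I \<Longrightarrow> continuous_on UNIV (g'' i)"
    using C2_obtain_family[of I g, OF C2] by metis
  have \<iota>x: "((\<lambda>y. (y, v)) has_derivative (\<lambda>h. (h, 0))) (at x)" for x :: 'x and v :: "real^'s"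
    by (intro derivative_intros)
  have \<iota>v: "((\<lambda>w. (x, w)) has_derivative (\<lambda>h. (0, h))) (at v)" for x :: 'x and v :: "real^'s"
    by (intro derivative_intros)
  have gx: "grad (\<lambda>y. g i (y, v)) x \<bullet> h = g' i (x, v) (h, 0)" if "i \<in> I" for i x v h
    by (rule grad_inner[OF has_derivative_compose[OF \<iota>x g'[OF that]]])
  have gv: "pgrad own i (\<lambda>w. g i (x, w)) v \<bullet> h = g' i (x, v) (0, component own i h)" if "i \<in> I" for i x v h
    by (rule pgrad_inner[OF has_derivative_compose[OF \<iota>v g'[OF that]]])
  have common': "g' i z (h, 0) = g' j z (h, 0)" if "i \<in> I" "j \<in> I" for i j z h
    using common[OF that] gx that by (cases z) metis
  have sym: "g'' i z (0, component own j h) (0, component own i k)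
      = g'' j z (0, component own i k) (0, component own j h)" if "i \<in> I" "j \<in> I" for i j z h k
    using second_derivative_eq_if_mixed_transpose[OF g'[OF that(1)] g''[OF that(1)] g'[OF that(2)] g''[OF that(2)]
        \<iota>v mixed[OF that]] by (cases z) simp
  obtain P where P: "C2 P"
    "\<And>z. (P has_derivative (\<lambda>(h, k). g' p z (h, 0) + (\<Sum>i\<in>I. g' i z (0, component own i k)))) (at z)"
    "\<And>i x x' y k. i \<in> I \<Longrightarrow> g i (x', y + component own i k) - P (x', y + component own i k)
      = g i (x, y) - P (x, y)"
    using block_potential[OF g' g'' cont I(1,2) bounded_linear_component sum_component[OF I(1,3)]
        component_component common' sym] by blast
  show thesis
  proof (rule that[OF P(1)])
    show "GDERIV P (x, v) :> (grad (\<lambda>y. g p (y, v)) x, \<Sum>i\<in>I. pgrad own i (\<lambda>w. g i (x, w)) v)" for x v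
      unfolding gderiv_def
      by (rule has_derivative_eq_rhs[OF P(2)])
        (simp add: fun_eq_iff inner_sum_right inner_commute[of _ "grad _ _"]
          inner_commute[of _ "pgrad _ _ _ _"] gx[OF I(2)] gv)
    \<comment> \<open>A deviation is a displacement within the player's block, which is the form of
      the invariance in \<open>P(3)\<close>.\<close>
    have "replace own i w v = v + component own i (w - v)" for i w and v :: "real^'s"
      by (simp add: replace_def component_def vec_eq_iff)
    then show "g i (x', replace own i w v) - P (x', replace own i w v) = g i (x, v) - P (x, v)"
      if "i \<in> I" for i x x' v w
      using P(3)[OF that] by simp
  qed
qed

text \<open>Here a player owns a block of \<open>u\<close> and a block of \<open>v\<close>. The
  hypotheses say nothing about derivatives mixing the two; these vanish by separability.\<close>

lemma stage_potential:
  fixes g :: "nat \<Rightarrow> 'x::euclidean_space \<times> (real^'m::finite) \<times> (real^'s::finite) \<Rightarrow> real"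
  assumes I: "finite I" "p \<in> I" "range uo \<subseteq> I" "range vo \<subseteq> I"
    and C2: "\<And>i. i \<in> I \<Longrightarrow> C2 (g i)"
    and separable: "\<And>i x u v. i \<in> I \<Longrightarrow> g i (x, u, v) = gu i (x, u) + gv i (x, v)"
    and common: "\<And>i j x u v. \<lbrakk>i \<in> I; j \<in> I\<rbrakk> \<Longrightarrow>
      grad (\<lambda>y. g i (y, u, v)) x = grad (\<lambda>y. g j (y, u, v)) x"
    and mixed_u: "\<And>i j x u v. \<lbrakk>i \<in> I; j \<in> I\<rbrakk> \<Longrightarrow>
      mixed uo j i (\<lambda>w. g i (x, w, v)) u = transpose (mixed uo i j (\<lambda>w. g j (x, w, v)) u)"
    and mixed_v: "\<And>i j x u v. \<lbrakk>i \<in> I; j \<in> I\<rbrakk> \<Longrightarrow>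
      mixed vo j i (\<lambda>w. g i (x, u, w)) v = transpose (mixed vo i j (\<lambda>w. g j (x, u, w)) v)"
  obtains P where "C2 P"
    "\<And>x u v. GDERIV P (x, u, v) :> (grad (\<lambda>y. g p (y, u, v)) x,
      \<Sum>i\<in>I. pgrad uo i (\<lambda>w. g i (x, w, v)) u, \<Sum>i\<in>I. pgrad vo i (\<lambda>w. g i (x, u, w)) v)"
    "\<And>i x x' u v w w'. i \<in> I \<Longrightarrow>
      g i (x', replace uo i w u, replace vo i w' v) - P (x', replace uo i w u, replace vo i w' v)
      = g i (x, u, v) - P (x, u, v)"
proof -
  obtain g' g'' where g': "\<And>i z. i \<in> I \<Longrightarrow> (g i has_derivative blinfun_apply (g' i z)) (at z)"
    and g'': "\<And>i z. i \<in> I \<Longrightarrow> (g' i has_derivative blinfun_apply (g'' i z)) (at z)"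
    and cont: "\<And>i. i \<in> I \<Longrightarrow> continuous_on UNIV (g'' i)"
    using C2_obtain_family[of I g, OF C2] by metis
  have \<iota>x: "((\<lambda>y. (y, u, v)) has_derivative (\<lambda>h. (h, 0))) (at x)"
    for x :: 'x and u :: "real^'m" and v :: "real^'s"
    by (intro derivative_intros)
  have \<iota>u: "((\<lambda>w. (x, w, v)) has_derivative (\<lambda>h. (0, h, 0))) (at u)"
    for x :: 'x and u :: "real^'m" and v :: "real^'s"
    by (intro derivative_intros)
  have \<iota>v: "((\<lambda>w. (x, u, w)) has_derivative (\<lambda>h. (0, 0, h))) (at v)"
    for x :: 'x and u :: "real^'m" and v :: "real^'s"
    by (intro derivative_intros)
  have gx: "grad (\<lambda>y. g i (y, u, v)) x \<bullet> h = g' i (x, u, v) (h, 0)" if "i \<in> I" for i x u v h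
    by (rule grad_inner[OF has_derivative_compose[OF \<iota>x g'[OF that]]])
  have gu: "pgrad uo i (\<lambda>w. g i (x, w, v)) u \<bullet> h = g' i (x, u, v) (0, component uo i h, 0)"
    if "i \<in> I" for i x u v h
    by (rule pgrad_inner[OF has_derivative_compose[OF \<iota>u g'[OF that]]])
  have gv: "pgrad vo i (\<lambda>w. g i (x, u, w)) v \<bullet> h = g' i (x, u, v) (0, 0, component vo i h)"
    if "i \<in> I" for i x u v h
    by (rule pgrad_inner[OF has_derivative_compose[OF \<iota>v g'[OF that]]])
  have common': "g' i z (h, 0) = g' j z (h, 0)" if "i \<in> I" "j \<in> I" for i j z h
    using common[OF that] gx that by (cases z) metis
  \<comment> \<open>By separability, changing \<open>u\<close> alters the cost as a function of
    \<open>v\<close> only by a constant, so the derivative in \<open>v\<close> does not depend on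
    \<open>u\<close>.\<close>
  have uv: "g'' i z (0, a, 0) (0, 0, b) = 0" if i: "i \<in> I" for i z a b
  proof -
    obtain x u v where z: "z = (x, u, v)" by (cases z) auto
    have "g' i (x, w, v) (0, 0, b) = g' i (x, u, v) (0, 0, b)" for w
    proof -
      have "(\<lambda>q. g i (x, w, q)) = (\<lambda>q. g i (x, u, q) + (gu i (x, w) - gu i (x, u)))"
        by (simp add: separable[OF i] fun_eq_iff)
      then have "((\<lambda>q. g i (x, w, q)) has_derivative (\<lambda>h. g' i (x, u, v) (0, 0, h))) (at v)"
        using has_derivative_add_const[OF has_derivative_compose[OF \<iota>v g'[OF i]]] by simp
      from has_derivative_unique[OF this has_derivative_compose[OF \<iota>v g'[OF i]]]
      show ?thesis by (simp add: fun_eq_iff)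
    qed
    then have "(\<lambda>w. g' i (x, w, v) (0, 0, b)) = (\<lambda>w. g' i (x, u, v) (0, 0, b))" by (rule ext)
    then have "((\<lambda>w. g' i (x, w, v) (0, 0, b)) has_derivative (\<lambda>h. 0)) (at u)"
      by (simp only: has_derivative_const)
    from has_derivative_unique[OF this
        has_derivative_compose[OF \<iota>u has_derivative_apply_blinfun[OF g''[OF i]]]]
    show ?thesis by (simp add: fun_eq_iff z)
  qed
  then have vu: "g'' i z (0, 0, b) (0, a, 0) = 0" if "i \<in> I" for i z a b
    using symmetric_second_derivative[OF g'[OF that] g''[OF that] cont[OF that], of z] that by metis
  \<comment> \<open>Both actions of a player are merged into one block of the joint vector
    \<open>(u, v)\<close>, so a simultaneous deviation in \<open>u\<close> and \<open>v\<close> is a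
    single displacement.\<close>
  define \<pi> where "\<pi> = (\<lambda>i (y :: (real^'m) \<times> (real^'s)). (component uo i (fst y), component vo i (snd y)))"
  have \<pi>: "bounded_linear (\<pi> i)" for i
    unfolding \<pi>_def
    by (intro bounded_linear_Pair bounded_linear_compose[OF bounded_linear_component]
        bounded_linear_fst bounded_linear_snd)
  have sum_\<pi>: "(\<Sum>i\<in>I. \<pi> i y) = y" for y
    by (simp add: \<pi>_def prod_eq_iff fst_sum snd_sum sum_component I)
  have \<pi>_\<pi>: "\<pi> i (\<pi> j y) = (if i = j then \<pi> i y else 0)" for i j y
    by (simp add: \<pi>_def zero_prod_def)
  have split: "(0 :: 'x, a, b) = (0, a, 0) + (0, 0, b)" for a :: "real^'m" and b :: "real^'s"
    by simp
  have sym: "g'' i z (0, \<pi> j h) (0, \<pi> i k) = g'' j z (0, \<pi> i k) (0, \<pi> j h)"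
    if "i \<in> I" "j \<in> I" for i j z h k
  proof -
    obtain x u v where z: "z = (x, u, v)" by (cases z) auto
    note transposed = second_derivative_eq_if_mixed_transpose[OF
        g'[OF that(1)] g''[OF that(1)] g'[OF that(2)] g''[OF that(2)]]
    have "g'' i z (0, component uo j a, 0) (0, component uo i b, 0)
        = g'' j z (0, component uo i b, 0) (0, component uo j a, 0)" for a b
      unfolding z by (rule transposed[OF \<iota>u mixed_u[OF that]])
    moreover have "g'' i z (0, 0, component vo j a) (0, 0, component vo i b)
        = g'' j z (0, 0, component vo i b) (0, 0, component vo j a)" for a b
      unfolding z by (rule transposed[OF \<iota>v mixed_v[OF that]])
    \<comment> \<open>Of the four products, the two mixing \<open>u\<close> and \<open>v\<close>
      vanish by \<open>uv\<close> and \<open>vu\<close>; the other two are the transposition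
      hypotheses.\<close>
    ultimately show ?thesis
      unfolding \<pi>_def split[of "component _ _ _" "component _ _ _"] blinfun.add_left blinfun.add_right
      by (simp add: uv vu that)
  qed
  obtain P where P: "C2 P"
    "\<And>z. (P has_derivative (\<lambda>(h, k). g' p z (h, 0) + (\<Sum>i\<in>I. g' i z (0, \<pi> i k)))) (at z)"
    "\<And>i x x' y k. i \<in> I \<Longrightarrow> g i (x', y + \<pi> i k) - P (x', y + \<pi> i k) = g i (x, y) - P (x, y)"
    using block_potential[OF g' g'' cont I(1,2) \<pi> sum_\<pi> \<pi>_\<pi> common' sym] by blast
  have g'_split: "g' i z (0, \<pi> i (a, b)) = g' i z (0, component uo i a, 0) + g' i z (0, 0, component vo i b)"
    for i z a b
    by (simp add: \<pi>_def flip: blinfun.add_right)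
  show thesis
  proof (rule that[OF P(1)])
    show "GDERIV P (x, u, v) :> (grad (\<lambda>y. g p (y, u, v)) x,
      \<Sum>i\<in>I. pgrad uo i (\<lambda>w. g i (x, w, v)) u, \<Sum>i\<in>I. pgrad vo i (\<lambda>w. g i (x, u, w)) v)" for x u v
      unfolding gderiv_def
      by (rule has_derivative_eq_rhs[OF P(2)])
        (simp add: fun_eq_iff inner_sum_right inner_commute[of _ "grad _ _"]
          inner_commute[of _ "pgrad _ _ _ _"] gx[OF I(2)] gu gv g'_split sum.distrib)
    have "(replace uo i w u, replace vo i w' v) = (u, v) + \<pi> i (w - u, w' - v)" for i w w' u v
      by (simp add: \<pi>_def replace_def component_def vec_eq_iff)
    then show "g i (x', replace uo i w u, replace vo i w' v) - P (x', replace uo i w u, replace vo i w' v)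
      = g i (x, u, v) - P (x, u, v)" if "i \<in> I" for i x x' u v w w'
      using P(3)[OF that] by simp
  qed
qed

section \<open>Assembly over all time periods\<close>

theorem theorem3p13:
  fixes G :: "('n::finite, 'm::finite, 's::finite, 'q::finite) nzdg"
  assumes "game_data G"
    and "standing_assumptions G"
    and "\<And>i j k x u v. \<lbrakk>i \<in> players G; j \<in> players G; k < horizon G\<rbrakk> \<Longrightarrow>
      mixed (uown G) j i (\<lambda>w. cost G i k (x, w, v)) u =
      transpose (mixed (uown G) i j (\<lambda>w. cost G j k (x, w, v)) u)"
    and "\<And>i j k x u v. \<lbrakk>i \<in> players G; j \<in> players G; k < horizon G\<rbrakk> \<Longrightarrow>
      grad (\<lambda>y. cost G i k (y, u, v)) x = grad (\<lambda>y. cost G j k (y, u, v)) x"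
    and "\<And>i j x v. \<lbrakk>i \<in> players G; j \<in> players G\<rbrakk> \<Longrightarrow>
      grad (\<lambda>y. tcost G i (y, v)) x = grad (\<lambda>y. tcost G j (y, v)) x"
    and "\<And>i j k x u v. \<lbrakk>i \<in> players G; j \<in> players G; k < horizon G\<rbrakk> \<Longrightarrow>
      mixed (vown G) j i (\<lambda>w. cost G i k (x, u, w)) v =
      transpose (mixed (vown G) i j (\<lambda>w. cost G j k (x, u, w)) v)"
    and "\<And>i j x v. \<lbrakk>i \<in> players G; j \<in> players G\<rbrakk> \<Longrightarrow>
      mixed (vown G) j i (\<lambda>w. tcost G i (x, w)) v =
      transpose (mixed (vown G) i j (\<lambda>w. tcost G j (x, w)) v)"
  shows "OLPDG G \<and>
    (\<forall>c z0 zT. (\<forall>k<horizon G. z0 k \<in> Omega G k) \<longrightarrow> zT \<in> OmegaT G \<longrightarrow>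
      (\<exists>P PT. potential_costs G P PT \<and>
        (\<forall>k<horizon G. line_integral_formula (Omega G k) (z0 k) (c k) (grad_field G k) (P k)) \<and>
        line_integral_formula (OmegaT G) zT (c (horizon G)) (grad_fieldT G) PT))"
proof -
  have own: "range (uown G) \<subseteq> players G" "range (vown G) \<subseteq> players G"
    using assms(1) by (auto simp: game_data_def)
  \<comment> \<open>Coordinate types are inhabited and every owner lies between 1 and N, so player 1
    exists.\<close>
  then have players: "finite (players G)" "1 \<in> players G"
    by (auto simp: players_def image_subset_iff intro: order_trans)
  have C2: "\<And>i k. \<lbrakk>i \<in> players G; k < horizon G\<rbrakk> \<Longrightarrow> C2 (cost G i k)" "\<And>i. i \<in> players G \<Longrightarrow> C2 (tcost G i)"
    using assms(2) by (auto simp: standing_assumptions_def)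
  have "\<exists>gu gv. \<forall>i\<in>players G. \<forall>k<horizon G. \<forall>x u v.
      cost G i k (x, u, v) = gu i k (x, u) + gv i k (x, v)"
    using assms(2) by (simp add: standing_assumptions_def)
  then obtain gu gv where separable: "\<And>i k x u v. \<lbrakk>i \<in> players G; k < horizon G\<rbrakk> \<Longrightarrow>
      cost G i k (x, u, v) = gu i k (x, u) + gv i k (x, v)"
    by metis
  define invariant where "invariant k P \<longleftrightarrow> (\<forall>i\<in>players G. \<forall>x x' u v w w'.
      cost G i k (x', replace (uown G) i w u, replace (vown G) i w' v)
        - P (x', replace (uown G) i w u, replace (vown G) i w' v)
      = cost G i k (x, u, v) - P (x, u, v))" for k P
  \<comment> \<open>The shared state derivative is taken from player 1, as in
    \<open>grad_field\<close>.\<close>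
  have "\<exists>P. C2 P \<and> (\<forall>z. GDERIV P z :> grad_field G k z) \<and> invariant k P" if k: "k < horizon G" for k
  proof -
    obtain P where "C2 P"
      "\<And>x u v. GDERIV P (x, u, v) :> (grad (\<lambda>y. cost G 1 k (y, u, v)) x,
        \<Sum>i\<in>players G. pgrad (uown G) i (\<lambda>w. cost G i k (x, w, v)) u,
        \<Sum>i\<in>players G. pgrad (vown G) i (\<lambda>w. cost G i k (x, u, w)) v)"
      "\<And>i x x' u v w w'. i \<in> players G \<Longrightarrow>
        cost G i k (x', replace (uown G) i w u, replace (vown G) i w' v)
          - P (x', replace (uown G) i w u, replace (vown G) i w' v)
        = cost G i k (x, u, v) - P (x, u, v)"
      using stage_potential[of _ 1 "uown G" "vown G" "\<lambda>i. cost G i k",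
          OF players own C2(1)[OF _ k] separable[OF _ k] assms(4)[OF _ _ k] assms(3)[OF _ _ k] assms(6)[OF _ _ k]]
      by blast
    then show ?thesis by (auto simp: grad_field_def invariant_def)
  qed
  then obtain P where P: "\<And>k. k < horizon G \<Longrightarrow> C2 (P k)"
    "\<And>k z. k < horizon G \<Longrightarrow> GDERIV (P k) z :> grad_field G k z"
    "\<And>k. k < horizon G \<Longrightarrow> invariant k (P k)"
    by metis
  obtain PT where PT: "C2 PT"
    "\<And>x v. GDERIV PT (x, v) :> (grad (\<lambda>y. tcost G 1 (y, v)) x,
      \<Sum>i\<in>players G. pgrad (vown G) i (\<lambda>w. tcost G i (x, w)) v)"
    "\<And>i x x' v w. i \<in> players G \<Longrightarrow>
      tcost G i (x', replace (vown G) i w v) - PT (x', replace (vown G) i w v)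
      = tcost G i (x, v) - PT (x, v)"
    using terminal_potential[OF players own(2) C2(2) assms(5) assms(7)] by blast
  have PT': "GDERIV PT z :> grad_fieldT G z" for z
    using PT(2) by (cases z) (simp add: grad_fieldT_def)
  \<comment> \<open>Added constants shift the difference of cost and potential equally at all
    points, so the invariance survives; this leaves the normalisation free.\<close>
  have shifted: "potential_costs G (\<lambda>k z. P k z + a k) (\<lambda>z. PT z + b)" for a b
  proof (rule potential_costs_if_deviation_invariant)
    show "C2 (\<lambda>z. P k z + a k)" if "k < horizon G" for k
      using P(1)[OF that] by (rule C2_shift)
    show "C2 (\<lambda>z. PT z + b)"
      using PT(1) by (rule C2_shift)
  qed (use P(3) PT(3) in \<open>auto simp: invariant_def diff_diff_eq[symmetric]\<close>)
  show ?thesis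
  proof (intro conjI allI impI)
    show "OLPDG G" using shifted unfolding OLPDG_def by blast
    fix c z0 zT
    show "\<exists>P PT. potential_costs G P PT \<and>
        (\<forall>k<horizon G. line_integral_formula (Omega G k) (z0 k) (c k) (grad_field G k) (P k)) \<and>
        line_integral_formula (OmegaT G) zT (c (horizon G)) (grad_fieldT G) PT"
      \<comment> \<open>The same gradient potentials serve all base points; the added constants make
        them equal to \<open>c k\<close> at \<open>z0 k\<close> and to \<open>c (horizon G)\<close>
        at \<open>zT\<close>.\<close>
      by (intro exI[of _ "\<lambda>k z. P k z + (c k - P k (z0 k))"]
          exI[of _ "\<lambda>z. PT z + (c (horizon G) - PT zT)"]
          conjI allI impI shifted line_integral_of_gradient P(2) PT')
  qed
qed

end
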